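(* Let $\mathcal M=\{k_1<\cdots<k_{M_n}\}$ be a nested candidate model set, and suppose $\mathbf y_{m|\mathcal M}\neq\mathbf 0$ for all $m=1,\ldots,M_n$ (which holds almost surely). Let $$C_n(\mathbf w|\mathcal M,\mathbf y)=\|\mathbf y-\hat{\boldsymbol\mu}_{\mathbf w|\mathcal M}\|^2+2\sigma^2\mathbf k^\top\mathbf w,\qquad \mathbf k=(k_1,\ldots,k_{M_n})^\top,$$ be the Mallows model averaging criterion. With $\gamma_m=\sum_{j=m}^{M_n}w_j$, it equals $$C_n(\boldsymbol\gamma|\mathcal M,\mathbf y)=\sum_{m=1}^{M_n}\left[\|\mathbf y_{m|\mathcal M}\|^2(1-\gamma_m)^2+2\sigma^2_{m|\mathcal M}\gamma_m\right]+\|\mathbf y_{M_n+1|\mathcal M}\|^2.$$ The minimizer of $C_n(\boldsymbol\gamma|\mathcal M,\mathbf y)$ over the hypercube $\tilde\Gamma_{M_n}=[0,1]^{M_n}$ (equivalently, the minimization of $C_n(\mathbf w|\mathcal M,\mathbf y)$ over $\tilde{\mathcal W}_{M_n}=\{\mathbf w\in\mathbb R^{M_n}:0\le\sum_{j=m}^{M_n}w_j\le1,\ m=1,\ldots,M_n\}$) is given by $$\hat\gamma_{\mathrm{STE},m}=\left(1-\frac{\sigma^2_{m|\mathcal M}}{\|\mathbf y_{m|\mathcal M}\|^2}\right)_+,\qquad m=1,\ldots,M_n,$$ and the corresponding model averaging estimator is the sum of positive-part Stein estimators $$\sum_{m=1}^{M_n}\left(1-\frac{\sigma^2_{m|\mathcal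 M}}{\|\mathbf y_{m|\mathcal M}\|^2}\right)_+\mathbf y_{m|\mathcal M}.$$
   Context: Setting. $\mathbf y=\boldsymbol\mu+\boldsymbol\varepsilon=\mathbf X\boldsymbol\beta+\boldsymbol\varepsilon\in\mathbb R^n$, where $\mathbf X=[\mathbf x_1,\ldots,\mathbf x_{p_n}]$ is a non-random $n\times p_n$ matrix of full column rank, $p_n\le n$, and $\boldsymbol\varepsilon$ has i.i.d. $N(0,\sigma^2)$ entries with $\sigma^2>0$ known. Candidate models. $\mathcal M=\{k_1<k_2<\cdots<k_{M_n}\}$ is a set of integers in $\{1,\ldots,p_n\}$, with $k_0=0$. $\mathbf P_k$ is the orthogonal projection onto the span of $\mathbf x_1,\ldots,\mathbf x_k$, and $\mathbf P_0=\mathbf 0$. The least-squares estimators are $\hat{\boldsymbol\mu}_{k_m}=\mathbf P_{k_m}\mathbf y$, and $\hat{\boldsymbol\mu}_{\mathbf w|\mathcal M}=\sum_{m=1}^{M_n}w_m\hat{\boldsymbol\mu}_{k_m}$. Block notation. $\mathbf D_{m|\mathcal M}=\mathbf P_{k_m}-\mathbf P_{k_{m-1}}$ for $1\le m\le M_n$ and $\mathbf D_{M_n+1|\mathcal M}=\mathbf I-\mathbf P_{k_{M_n}}$; $\mathbf y_{m|\mathcal M}=\mathbf D_{m|\mathcal M}\mathbf y$; $\sigma^2_{m|\mathcal M}=(k_m-k_{m-1})\sigma^2$; $x_+=\max(x,0)$; $\|\cdot\|$ is the Euclidean norm. Relation of weights. A cumulative weight vector $\boldsymbol\gamma$ corresponds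 to the weights $w_m=\gamma_m-\gamma_{m+1}$, $m=1,\ldots,M_n$, with $\gamma_{M_n+1}=0$. *)

theory Defs
  imports "HOL-Probability.Probability"
begin

text \<open>
  The design matrix is given by its columns \<open>x 1, \<dots>, x p\<close>. A candidate model set is a finite
  set \<open>K\<close> of positive naturals, and \<open>card K\<close> is the number of candidate models. Vectors indexed by
  the candidate models are functions on \<open>{1..card K}\<close> in the sense of the constant
  \<^const>\<open>extensional\<close>, so that equality of functions is equality of vectors.
\<close>

definition orth_proj :: "(real ^ 'n) set \<Rightarrow> real ^ 'n ^ 'n" where
  "orth_proj S = (THE P. \<forall>y. P *v y \<in> span S \<and> (\<forall>v\<in>span S. orthogonal (y - P *v y) v))"

lemma orth_proj_props:
  fixes S :: "(real ^ 'n) set"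
  shows "orth_proj S *v y \<in> span S"
    and "v \<in> span S \<Longrightarrow> orthogonal (y - orth_proj S *v y) v"
proof -
  let ?Q = "\<lambda>y p. p \<in> span S \<and> (\<forall>v\<in>span S. orthogonal (y - p) v)"
  have uniq: "p = q" if "?Q y p" "?Q y q" for y p q
  proof -
    have d: "p - q \<in> span S" using that by (simp add: span_diff)
    have "(y - q) \<bullet> (p - q) = 0" "(y - p) \<bullet> (p - q) = 0"
      using that d by (auto simp: orthogonal_def)
    then have "(p - q) \<bullet> (p - q) = 0"
      by (simp add: inner_diff_left)
    then show ?thesis by simp
  qed
  have ex: "\<exists>p. ?Q y p" for y
  proof -
    obtain a b where "a \<in> span S" "\<And>w. w \<in> span S \<Longrightarrow> orthogonal b w" "y = a + b"
      using orthogonal_subspace_decomp_exists[of S y] by metis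
    then show ?thesis by (intro exI[of _ a]) auto
  qed
  define f where "f y = (SOME p. ?Q y p)" for y
  have f: "?Q y (f y)" for y
    unfolding f_def using ex by (rule someI_ex)
  have "linear f"
  proof (rule linearI)
    fix y z
    have "?Q (y + z) (f y + f z)"
    proof (intro conjI ballI)
      show "f y + f z \<in> span S" using f by (simp add: span_add)
      fix v assume "v \<in> span S"
      then have "orthogonal (y - f y) v" "orthogonal (z - f z) v" using f by auto
      then show "orthogonal (y + z - (f y + f z)) v"
        by (simp add: orthogonal_def inner_diff_left inner_add_left)
    qed
    then show "f (y + z) = f y + f z" using f uniq by metis
  next
    fix c y
    have "?Q (c *\<^sub>R y) (c *\<^sub>R f y)"
    proof (intro conjI ballI)
      show "c *\<^sub>R f y \<in> span S" using f by (simp add: span_scale)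
      fix v assume "v \<in> span S"
      then have "orthogonal (y - f y) v" using f by auto
      then show "orthogonal (c *\<^sub>R y - c *\<^sub>R f y) v"
        by (simp add: orthogonal_def inner_diff_left)
    qed
    then show "f (c *\<^sub>R y) = c *\<^sub>R f y" using f uniq by metis
  qed
  then have mf: "matrix f *v y = f y" for y
    by (simp add: matrix_works)
  have "\<forall>y. ?Q y (orth_proj S *v y)"
    unfolding orth_proj_def
  proof (rule theI)
    show "\<forall>y. ?Q y (matrix f *v y)" using f by (simp add: mf)
    fix P :: "real ^ 'n ^ 'n" assume "\<forall>y. ?Q y (P *v y)"
    then have "P *v y = matrix f *v y" for y
      using f uniq mf by metis
    then show "P = matrix f" by (simp add: matrix_eq)
  qed
  then show "orth_proj S *v y \<in> span S"
    and "v \<in> span S \<Longrightarrow> orthogonal (y - orth_proj S *v y) v" by auto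
qed

definition proj_mat :: "(nat \<Rightarrow> real ^ 'n) \<Rightarrow> nat \<Rightarrow> real ^ 'n ^ 'n" where
  "proj_mat x k = orth_proj (x ` {1..k})"

lemma proj_mat_0: "proj_mat x 0 = (0 :: real ^ 'n ^ 'n)"
  using orth_proj_props(1)[of "{} :: (real ^ 'n) set"]
  by (simp add: proj_mat_def matrix_eq)

definition model_size :: "nat set \<Rightarrow> nat \<Rightarrow> nat" where
  "model_size K m = (if m = 0 then 0 else sorted_list_of_set K ! (m - 1))"

definition block_mat :: "(nat \<Rightarrow> real ^ 'n) \<Rightarrow> nat set \<Rightarrow> nat \<Rightarrow> real ^ 'n ^ 'n" where
  "block_mat x K m =
     (if m \<le> card K then proj_mat x (model_size K m) - proj_mat x (model_size K (m - 1))
      else mat 1 - proj_mat x (model_size K (card K)))"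

definition block_obs :: "(nat \<Rightarrow> real ^ 'n) \<Rightarrow> nat set \<Rightarrow> real ^ 'n \<Rightarrow> nat \<Rightarrow> real ^ 'n" where
  "block_obs x K y m = block_mat x K m *v y"

definition block_var :: "real \<Rightarrow> nat set \<Rightarrow> nat \<Rightarrow> real" where
  "block_var \<sigma> K m = (real (model_size K m) - real (model_size K (m - 1))) * \<sigma>\<^sup>2"

definition ls_est :: "(nat \<Rightarrow> real ^ 'n) \<Rightarrow> real ^ 'n \<Rightarrow> nat \<Rightarrow> real ^ 'n" where
  "ls_est x y k = proj_mat x k *v y"

definition ma_est :: "(nat \<Rightarrow> real ^ 'n) \<Rightarrow> nat set \<Rightarrow> real ^ 'n \<Rightarrow> (nat \<Rightarrow> real) \<Rightarrow> real ^ 'n" where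
  "ma_est x K y w = (\<Sum>m=1..card K. w m *\<^sub>R ls_est x y (model_size K m))"

definition mallows_crit ::
    "(nat \<Rightarrow> real ^ 'n) \<Rightarrow> real \<Rightarrow> nat set \<Rightarrow> real ^ 'n \<Rightarrow> (nat \<Rightarrow> real) \<Rightarrow> real" where
  "mallows_crit x \<sigma> K y w =
     (norm (y - ma_est x K y w))\<^sup>2 + 2 * \<sigma>\<^sup>2 * (\<Sum>m=1..card K. real (model_size K m) * w m)"

definition mallows_crit_cum ::
    "(nat \<Rightarrow> real ^ 'n) \<Rightarrow> real \<Rightarrow> nat set \<Rightarrow> real ^ 'n \<Rightarrow> (nat \<Rightarrow> real) \<Rightarrow> real" where
  "mallows_crit_cum x \<sigma> K y \<gamma> =
     (\<Sum>m=1..card K. (norm (block_obs x K y m))\<^sup>2 * (1 - \<gamma> m)\<^sup>2 + 2 * block_var \<sigma> K m * \<gamma> m)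
     + (norm (block_obs x K y (card K + 1)))\<^sup>2"

definition cum_weights :: "nat \<Rightarrow> (nat \<Rightarrow> real) \<Rightarrow> nat \<Rightarrow> real" where
  "cum_weights M w = (\<lambda>m\<in>{1..M}. \<Sum>j=m..M. w j)"

text \<open>The case distinction is the convention that the cumulative weight at \<open>M + 1\<close> is 0.\<close>

definition weights_of_cum :: "nat \<Rightarrow> (nat \<Rightarrow> real) \<Rightarrow> nat \<Rightarrow> real" where
  "weights_of_cum M \<gamma> = (\<lambda>m\<in>{1..M}. \<gamma> m - (if m = M then 0 else \<gamma> (m + 1)))"

definition cum_cube :: "nat \<Rightarrow> (nat \<Rightarrow> real) set" where
  "cum_cube M = {1..M} \<rightarrow>\<^sub>E {0..1}"

definition weight_set :: "nat \<Rightarrow> (nat \<Rightarrow> real) set" where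
  "weight_set M =
     {w \<in> extensional {1..M}. \<forall>m\<in>{1..M}. 0 \<le> (\<Sum>j=m..M. w j) \<and> (\<Sum>j=m..M. w j) \<le> 1}"

definition gamma_ste ::
    "(nat \<Rightarrow> real ^ 'n) \<Rightarrow> real \<Rightarrow> nat set \<Rightarrow> real ^ 'n \<Rightarrow> nat \<Rightarrow> real" where
  "gamma_ste x \<sigma> K y =
     (\<lambda>m\<in>{1..card K}. max (1 - block_var \<sigma> K m / (norm (block_obs x K y m))\<^sup>2) 0)"

end

theory Submission
  imports Defs
begin

text \<open>
  Summation by parts turns the averaged estimator into a combination of the block observations
  with the cumulative weights as coefficients. The blocks are pairwise orthogonal, so by
  Pythagoras the criterion is a sum of one-variable quadratics
  \<open>a (1 - g)\<^sup>2 + 2 s g\<close> and can be minimised coordinatewise over the cube. Completing the square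
  gives an excess of at least \<open>a (g - t)\<^sup>2\<close> over the value at \<open>t = max (1 - s / a) 0\<close>, hence
  existence and uniqueness of the minimiser. A block observation is almost surely nonzero because
  its inner product with some fixed nonzero vector equals that of \<open>y\<close>, a nondegenerate Gaussian.
\<close>

section \<open>Summation by parts and the change to cumulative weights\<close>

text \<open>Raising \<open>M\<close> by one adds \<open>w (Suc M)\<close> to every tail sum, and the
  increments of \<open>f\<close> telescope because \<open>f 0 = 0\<close>. A general vector space
  serves two uses: the fitted vectors and the real model sizes.\<close>

lemma sum_by_parts_tails:
  fixes f :: "nat \<Rightarrow> 'b::real_vector" and w :: "nat \<Rightarrow> real"
  assumes "f 0 = 0"
  shows "(\<Sum>m=1..M. w m *\<^sub>R f m) = (\<Sum>m=1..M. (\<Sum>j=m..M. w j) *\<^sub>R (f m - f (m - 1)))"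
proof (induction M)
  case (Suc M)
  have telescope: "(\<Sum>m=1..N. f m - f (m - 1)) = f N" for N
    using assms by (induction N) auto
  \<comment> \<open>At \<open>m = Suc M\<close> the inner sum over \<open>{m..M}\<close> is empty,
    so the split is valid for the last index too.\<close>
  have "(\<Sum>m=1..Suc M. (\<Sum>j=m..Suc M. w j) *\<^sub>R (f m - f (m - 1)))
      = (\<Sum>m=1..Suc M. (\<Sum>j=m..M. w j) *\<^sub>R (f m - f (m - 1)) + w (Suc M) *\<^sub>R (f m - f (m - 1)))"
    by (intro sum.cong) (auto simp: scaleR_add_left)
  also have "\<dots> = (\<Sum>m=1..M. (\<Sum>j=m..M. w j) *\<^sub>R (f m - f (m - 1))) + w (Suc M) *\<^sub>R f (Suc M)"
    using telescope[of "Suc M"] by (simp only: sum.distrib scaleR_sum_right[symmetric]) simp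
  finally show ?case using Suc by simp
qed simp

lemma weights_of_cum_cum_weights:
  assumes "w \<in> extensional {1..M}"
  shows "weights_of_cum M (cum_weights M w) = w"
proof
  fix m
  show "weights_of_cum M (cum_weights M w) m = w m"
  proof (cases "m \<in> {1..M}")
    case True
    then have "(\<Sum>j=m..M. w j) = w m + (\<Sum>j=Suc m..M. w j)"
      by (simp add: sum.atLeast_Suc_atMost)
    with True show ?thesis by (auto simp: weights_of_cum_def cum_weights_def)
  next
    case False
    with assms show ?thesis by (auto simp: weights_of_cum_def extensional_def)
  qed
qed

lemma cum_weights_weights_of_cum:
  assumes "\<gamma> \<in> extensional {1..M}"
  shows "cum_weights M (weights_of_cum M \<gamma>) = \<gamma>"
proof
  fix m
  show "cum_weights M (weights_of_cum M \<gamma>) m = \<gamma> m"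
  proof (cases "m \<in> {1..M}")
    case True
    \<comment> \<open>Extending \<open>\<gamma>\<close> by 0 at \<open>Suc M\<close> removes the
      case distinction from the weights, whose sum then telescopes.\<close>
    define g where "g j = (if j = Suc M then 0 else \<gamma> j)" for j
    have "(\<Sum>j=m..M. weights_of_cum M \<gamma> j) = (\<Sum>j=m..M. g j - g (Suc j))"
      using True by (intro sum.cong) (auto simp: weights_of_cum_def g_def)
    also have "\<dots> = g m - g (Suc M)"
      using True sum_Suc_diff[of m "Suc M" "\<lambda>j. - g j"] sum_Suc_diff[of m M "\<lambda>j. - g j"] by simp
    finally show ?thesis using True by (simp add: cum_weights_def g_def)
  next
    case False
    with assms show ?thesis by (auto simp: cum_weights_def extensional_def)
  qed
qed

text \<open>The constraints of \<open>weight_set\<close> are the cube constraints read on tail sums,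
  so the two inversion lemmas suffice. The bijection carries minimisation from one set to the
  other.\<close>

lemma bij_betw_cum_weights: "bij_betw (cum_weights M) (weight_set M) (cum_cube M)"
proof (rule bij_betw_byWitness[where f' = "weights_of_cum M"])
  show "\<forall>w\<in>weight_set M. weights_of_cum M (cum_weights M w) = w"
    by (simp add: weight_set_def weights_of_cum_cum_weights)
  show "\<forall>\<gamma>\<in>cum_cube M. cum_weights M (weights_of_cum M \<gamma>) = \<gamma>"
    by (simp add: cum_cube_def PiE_def cum_weights_weights_of_cum)
  show "cum_weights M ` weight_set M \<subseteq> cum_cube M"
    by (auto simp: weight_set_def cum_cube_def cum_weights_def)
  show "weights_of_cum M ` cum_cube M \<subseteq> weight_set M"
  proof (rule image_subsetI)
    fix \<gamma> assume \<gamma>: "\<gamma> \<in> cum_cube M"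
    then have eq: "cum_weights M (weights_of_cum M \<gamma>) = \<gamma>"
      by (simp add: cum_cube_def PiE_def cum_weights_weights_of_cum)
    have "(\<Sum>j=m..M. weights_of_cum M \<gamma> j) = \<gamma> m" if "m \<in> {1..M}" for m
      using that fun_cong[OF eq, of m] by (simp add: cum_weights_def)
    moreover have "0 \<le> \<gamma> m \<and> \<gamma> m \<le> 1" if "m \<in> {1..M}" for m
      using PiE_mem[OF \<gamma>[unfolded cum_cube_def] that] by simp
    ultimately show "weights_of_cum M \<gamma> \<in> weight_set M"
      by (auto simp: weight_set_def weights_of_cum_def)
  qed
qed

section \<open>Ordering of the model sizes\<close>

lemma model_size_0 [simp]: "model_size K 0 = 0"
  by (simp add: model_size_def)

lemma model_size_mem:
  assumes "finite K" "m \<in> {1..card K}"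
  shows "model_size K m \<in> K"
proof -
  have "m - 1 < length (sorted_list_of_set K)"
    using assms by auto
  then have "sorted_list_of_set K ! (m - 1) \<in> set (sorted_list_of_set K)"
    by (rule nth_mem)
  with assms show ?thesis by (simp add: model_size_def)
qed

lemma model_size_less:
  assumes "finite K" "0 \<notin> K" "i < j" "j \<le> card K"
  shows "model_size K i < model_size K j"
\<comment> \<open>Index 0 is the empty model, not an entry of the sorted list. There the inequality
  is positivity of the size at \<open>j\<close>, a consequence of
  \<open>0 \<notin> K\<close>.\<close>
proof (cases "i = 0")
  case True
  with assms model_size_mem[of K j] show ?thesis
    by (cases "model_size K j = 0") auto
next
  case False
  have "sorted_wrt (<) (sorted_list_of_set K)" by simp
  from sorted_wrt_nth_less[OF this, of "i - 1" "j - 1"] show ?thesis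
    using False assms by (simp add: model_size_def)
qed

lemma model_size_mono:
  assumes "finite K" "0 \<notin> K" "i \<le> j" "j \<le> card K"
  shows "model_size K i \<le> model_size K j"
  using assms model_size_less[of K i j] by (cases "i = j") auto

section \<open>Nested projections and orthogonality of the blocks\<close>

lemma proj_mat_in_span: "proj_mat x k *v y \<in> span (x ` {1..k})"
  unfolding proj_mat_def by (rule orth_proj_props)

lemma orthogonal_proj_mat_residual:
  assumes "v \<in> span (x ` {1..k})"
  shows "orthogonal (y - proj_mat x k *v y) v"
  unfolding proj_mat_def using assms by (rule orth_proj_props)

lemma span_columns_mono: "k \<le> l \<Longrightarrow> span (x ` {1..k::nat}) \<subseteq> span (x ` {1..l})"
  by (intro span_mono image_mono) auto

lemma block_obs_eq:
  assumes "m \<le> card K"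
  shows "block_obs x K y m
    = proj_mat x (model_size K m) *v y - proj_mat x (model_size K (m - 1)) *v y"
  using assms by (simp add: block_obs_def block_mat_def matrix_vector_mult_diff_rdistrib)

lemma block_obs_Suc_card:
  "block_obs x K y (Suc (card K)) = y - proj_mat x (model_size K (card K)) *v y"
  by (simp add: block_obs_def block_mat_def matrix_vector_mult_diff_rdistrib)

lemma block_obs_in_span:
  assumes "finite K" "0 \<notin> K" "m \<le> card K"
  shows "block_obs x K y m \<in> span (x ` {1..model_size K m})"
proof -
  have "model_size K (m - 1) \<le> model_size K m"
    using assms by (intro model_size_mono) auto
  from span_columns_mono[OF this, of x] show ?thesis
    unfolding block_obs_eq[OF assms(3)]
    by (intro span_diff proj_mat_in_span) (use proj_mat_in_span in blast)
qed

text \<open>A block with \<open>m \<le> card K\<close> is the difference of two residuals, from the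
  models \<open>m - 1\<close> and \<open>m\<close>. Both are orthogonal to the smaller span. The
  last block is itself a residual.\<close>

lemma block_obs_orthogonal_span:
  assumes K: "finite K" "0 \<notin> K" and m: "m \<le> Suc (card K)"
    and v: "v \<in> span (x ` {1..model_size K (m - 1)})"
  shows "orthogonal (block_obs x K y m) v"
proof (cases "m \<le> card K")
  case True
  have "model_size K (m - 1) \<le> model_size K m"
    using K True by (intro model_size_mono) auto
  from span_columns_mono[OF this, of x] v
  have "orthogonal (y - proj_mat x (model_size K m) *v y) v"
    by (intro orthogonal_proj_mat_residual) auto
  with orthogonal_proj_mat_residual[OF v, of y] True show ?thesis
    by (simp add: block_obs_eq orthogonal_def inner_diff_left)
next
  case False
  with m have [simp]: "m = Suc (card K)" by simp
  from orthogonal_proj_mat_residual[OF v, of y] show ?thesis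
    by (simp add: block_obs_Suc_card)
qed

lemma pairwise_orthogonal_block_obs:
  assumes K: "finite K" "0 \<notin> K"
  shows "pairwise (\<lambda>i j. orthogonal (block_obs x K y i) (block_obs x K y j)) {1..Suc (card K)}"
proof -
  have ord: "orthogonal (block_obs x K y j) (block_obs x K y i)"
    if "i < j" "j \<le> Suc (card K)" for i j
  proof (rule block_obs_orthogonal_span[OF K that(2)])
    \<comment> \<open>Comparing with \<open>j - 1\<close> keeps the index at most
      \<open>card K\<close> even when \<open>j\<close> is the residual block.\<close>
    have "model_size K i \<le> model_size K (j - 1)"
      using K that by (intro model_size_mono) auto
    from span_columns_mono[OF this, of x] block_obs_in_span[OF K, of i x y] that
    show "block_obs x K y i \<in> span (x ` {1..model_size K (j - 1)})" by auto
  qed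
  show ?thesis
    unfolding pairwise_def by (metis atLeastAtMost_iff linorder_neqE_nat ord orthogonal_commute)
qed

section \<open>The Mallows criterion in block coordinates\<close>

lemma ma_est_eq_sum_block_obs:
  "ma_est x K y w = (\<Sum>m=1..card K. cum_weights (card K) w m *\<^sub>R block_obs x K y m)"
proof -
  have "ma_est x K y w
      = (\<Sum>m=1..card K. (\<Sum>j=m..card K. w j) *\<^sub>R
          (ls_est x y (model_size K m) - ls_est x y (model_size K (m - 1))))"
    \<comment> \<open>The side condition \<open>f 0 = 0\<close> is the vanishing of the projection
      for the empty model.\<close>
    unfolding ma_est_def by (rule sum_by_parts_tails) (simp add: ls_est_def proj_mat_0)
  also have "\<dots> = (\<Sum>m=1..card K. cum_weights (card K) w m *\<^sub>R block_obs x K y m)"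
    by (intro sum.cong) (auto simp: cum_weights_def block_obs_eq ls_est_def)
  finally show ?thesis .
qed

lemma sum_block_obs: "(\<Sum>m=1..Suc (card K). block_obs x K y m) = y"
proof -
  have "(\<Sum>m=1..N. block_obs x K y m) = proj_mat x (model_size K N) *v y" if "N \<le> card K" for N
    using that by (induction N) (auto simp: proj_mat_0 block_obs_eq)
  from this[of "card K"] show ?thesis by (simp add: block_obs_Suc_card)
qed

lemma mallows_crit_eq_cum:
  assumes K: "finite K" "0 \<notin> K"
  shows "mallows_crit x \<sigma> K y w = mallows_crit_cum x \<sigma> K y (cum_weights (card K) w)"
proof -
  let ?M = "card K" and ?g = "cum_weights (card K) w" and ?D = "block_obs x K y"
  \<comment> \<open>These are the coefficients of all blocks in the fitting residual. The value 1 at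
    \<open>Suc ?M\<close>, outside the range of the cumulative weights, puts the residual block into
    the same sum, so that Pythagoras applies once.\<close>
  define r where "r m = (if m = Suc ?M then 1 else 1 - ?g m)" for m
  have "y - ma_est x K y w = (\<Sum>m=1..Suc ?M. ?D m) - (\<Sum>m=1..?M. ?g m *\<^sub>R ?D m)"
    by (simp only: sum_block_obs ma_est_eq_sum_block_obs)
  also have "\<dots> = (\<Sum>m=1..?M. (1 - ?g m) *\<^sub>R ?D m) + ?D (Suc ?M)"
    by (simp add: scaleR_diff_left sum_subtractf)
  also have "(\<Sum>m=1..?M. (1 - ?g m) *\<^sub>R ?D m) = (\<Sum>m=1..?M. r m *\<^sub>R ?D m)"
    by (intro sum.cong) (auto simp: r_def)
  also have "\<dots> + ?D (Suc ?M) = (\<Sum>m=1..Suc ?M. r m *\<^sub>R ?D m)"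
    by (simp add: r_def)
  finally have "(norm (y - ma_est x K y w))\<^sup>2 = (norm (\<Sum>m=1..Suc ?M. r m *\<^sub>R ?D m))\<^sup>2"
    by simp
  also have "\<dots> = (\<Sum>m=1..Suc ?M. (norm (r m *\<^sub>R ?D m))\<^sup>2)"
    using pairwise_orthogonal_block_obs[OF K, of x y]
    by (intro norm_sum_Pythagorean) (auto simp: pairwise_def orthogonal_clauses)
  also have "\<dots> = (\<Sum>m=1..?M. (norm (r m *\<^sub>R ?D m))\<^sup>2) + (norm (?D (Suc ?M)))\<^sup>2"
    by (simp add: r_def)
  also have "(\<Sum>m=1..?M. (norm (r m *\<^sub>R ?D m))\<^sup>2) = (\<Sum>m=1..?M. (norm (?D m))\<^sup>2 * (1 - ?g m)\<^sup>2)"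
    by (intro sum.cong) (auto simp: r_def power_mult_distrib)
  finally have fit: "(norm (y - ma_est x K y w))\<^sup>2
    = (\<Sum>m=1..?M. (norm (?D m))\<^sup>2 * (1 - ?g m)\<^sup>2) + (norm (?D (Suc ?M)))\<^sup>2" .
  \<comment> \<open>The same summation by parts, now on the sizes, turns the penalty into tail sums
    times size increments; the factor \<open>\<sigma>\<^sup>2\<close> makes these increments block
    variances.\<close>
  have "(\<Sum>m=1..?M. real (model_size K m) * w m)
      = (\<Sum>m=1..?M. (\<Sum>j=m..?M. w j) * (real (model_size K m) - real (model_size K (m - 1))))"
    using sum_by_parts_tails[of "\<lambda>m. real (model_size K m)" w ?M] by (simp add: mult.commute)
  also have "2 * \<sigma>\<^sup>2 * \<dots> = (\<Sum>m=1..?M. 2 * block_var \<sigma> K m * ?g m)"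
    unfolding sum_distrib_left
    by (intro sum.cong) (auto simp: block_var_def cum_weights_def)
  finally show ?thesis
    unfolding mallows_crit_def mallows_crit_cum_def fit by (simp add: sum.distrib)
qed

section \<open>Coordinatewise minimisation\<close>

text \<open>The vertex of the quadratic is \<open>1 - s / a\<close>. If \<open>s \<le> a\<close>,
  then \<open>t\<close> is the vertex and equality holds. Otherwise \<open>t = 0\<close> and the two
  sides differ by \<open>2 * g * (s - a)\<close>, which is nonnegative as
  \<open>g \<ge> 0\<close>.\<close>

lemma block_loss_ge:
  fixes a s g :: real
  assumes "a > 0" "g \<ge> 0"
  defines "t \<equiv> max (1 - s / a) 0"
  shows "a * (1 - t)\<^sup>2 + 2 * s * t + a * (g - t)\<^sup>2 \<le> a * (1 - g)\<^sup>2 + 2 * s * g"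
proof (cases "s \<le> a")
  case True
  then have "t = 1 - s / a" using assms by (simp add: t_def)
  then have s: "s = a * (1 - t)" using assms by (simp add: field_simps)
  show ?thesis unfolding s by (simp add: power2_eq_square algebra_simps)
next
  case False
  then have t: "t = 0" using assms by (simp add: t_def)
  have "0 \<le> 2 * (g * (s - a))" using False assms by simp
  then show ?thesis by (simp add: t power2_eq_square algebra_simps)
qed

lemma block_var_nonneg:
  assumes "finite K" "0 \<notin> K" "m \<le> card K"
  shows "block_var \<sigma> K m \<ge> 0"
  using model_size_mono[OF assms(1,2), of "m - 1" m] assms(3) by (simp add: block_var_def)

text \<open>The positive part gives the bound 0, and nonnegativity of the block variances the bound
  1. A vanishing block is covered: division by zero makes its coordinate 1.\<close>

lemma gamma_ste_in_cum_cube: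
  assumes "finite K" "0 \<notin> K"
  shows "gamma_ste x \<sigma> K y \<in> cum_cube (card K)"
  using block_var_nonneg[OF assms, of _ \<sigma>] by (auto simp: gamma_ste_def cum_cube_def)

text \<open>The criterion is separable, so the coordinate gaps add up. Strictness comes from one
  differing coordinate, whose gap is positive because its block is nonzero.\<close>

lemma mallows_crit_cum_gamma_ste_less:
  assumes nz: "\<forall>m\<in>{1..card K}. block_obs x K y m \<noteq> 0"
    and \<gamma>: "\<gamma> \<in> cum_cube (card K)" "\<gamma> \<noteq> gamma_ste x \<sigma> K y"
  shows "mallows_crit_cum x \<sigma> K y (gamma_ste x \<sigma> K y) < mallows_crit_cum x \<sigma> K y \<gamma>"
proof -
  let ?t = "gamma_ste x \<sigma> K y"
  let ?a = "\<lambda>m. (norm (block_obs x K y m))\<^sup>2"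
  let ?f = "\<lambda>\<gamma> m. ?a m * (1 - \<gamma> m)\<^sup>2 + 2 * block_var \<sigma> K m * \<gamma> m"
  have gap: "?f ?t m + ?a m * (\<gamma> m - ?t m)\<^sup>2 \<le> ?f \<gamma> m" if m: "m \<in> {1..card K}" for m
  proof -
    have "?a m > 0" "\<gamma> m \<ge> 0"
      using nz PiE_mem[OF \<gamma>(1)[unfolded cum_cube_def] m] m by auto
    from block_loss_ge[OF this, of "block_var \<sigma> K m"] m show ?thesis
      by (simp add: gamma_ste_def)
  qed
  obtain m where m: "m \<in> {1..card K}" "\<gamma> m \<noteq> ?t m"
  proof -
    \<comment> \<open>Extensional functions agree outside the index set, so distinct ones differ at
      some index in it.\<close>
    have "\<gamma> \<in> extensional {1..card K}" "?t \<in> extensional {1..card K}"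
      using \<gamma>(1) by (auto simp: cum_cube_def PiE_def gamma_ste_def)
    with \<gamma>(2) that show ?thesis by (meson extensionalityI)
  qed
  have "(\<Sum>m=1..card K. ?f ?t m) < (\<Sum>m=1..card K. ?f \<gamma> m)"
  proof (rule sum_strict_mono_ex1)
    show "\<forall>m\<in>{1..card K}. ?f ?t m \<le> ?f \<gamma> m"
    proof
      fix m assume "m \<in> {1..card K}"
      moreover have "0 \<le> ?a m * (\<gamma> m - ?t m)\<^sup>2" by simp
      ultimately show "?f ?t m \<le> ?f \<gamma> m" using gap[of m] by linarith
    qed
    have "0 < ?a m * (\<gamma> m - ?t m)\<^sup>2" using m nz by simp
    with gap[OF m(1)] have "?f ?t m < ?f \<gamma> m" by linarith
    with m(1) show "\<exists>m\<in>{1..card K}. ?f ?t m < ?f \<gamma> m" by blast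
  qed simp
  then show ?thesis by (simp add: mallows_crit_cum_def)
qed

text \<open>Strict domination yields existence and uniqueness of the minimiser together.\<close>

lemma is_arg_min_iff_strict:
  fixes f :: "'b \<Rightarrow> real"
  assumes "t \<in> S" "\<And>s. s \<in> S \<Longrightarrow> s \<noteq> t \<Longrightarrow> f t < f s"
  shows "is_arg_min f (\<lambda>s. s \<in> S) s \<longleftrightarrow> s = t"
  using assms unfolding is_arg_min_def by (metis less_asym)

lemma is_arg_min_mallows_crit_cum:
  assumes "finite K" "0 \<notin> K" "\<forall>m\<in>{1..card K}. block_obs x K y m \<noteq> 0"
  shows "is_arg_min (mallows_crit_cum x \<sigma> K y) (\<lambda>g. g \<in> cum_cube (card K)) \<gamma>
    \<longleftrightarrow> \<gamma> = gamma_ste x \<sigma> K y"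
  using assms
  by (intro is_arg_min_iff_strict gamma_ste_in_cum_cube mallows_crit_cum_gamma_ste_less)

text \<open>The strict inequality on the cube is pulled back along the bijection: distinct weights
  have distinct cumulative weights, and the two forms of the criterion agree.\<close>

lemma is_arg_min_mallows_crit:
  assumes K: "finite K" "0 \<notin> K" and nz: "\<forall>m\<in>{1..card K}. block_obs x K y m \<noteq> 0"
  shows "is_arg_min (mallows_crit x \<sigma> K y) (\<lambda>v. v \<in> weight_set (card K)) w
    \<longleftrightarrow> w = weights_of_cum (card K) (gamma_ste x \<sigma> K y)"
proof (rule is_arg_min_iff_strict)
  let ?W = "weight_set (card K)" and ?t = "gamma_ste x \<sigma> K y"
  note bij = bij_betw_cum_weights[of "card K"]
  have t: "?t \<in> cum_cube (card K)" using K by (rule gamma_ste_in_cum_cube)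
  then have cum_t: "cum_weights (card K) (weights_of_cum (card K) ?t) = ?t"
    by (simp add: cum_cube_def PiE_def cum_weights_weights_of_cum)
  have inv: "weights_of_cum (card K) (cum_weights (card K) v) = v" if "v \<in> ?W" for v
    using that by (simp add: weight_set_def weights_of_cum_cum_weights)
  \<comment> \<open>By surjectivity \<open>?t\<close> has a preimage in \<open>?W\<close>, and the
    left inverse identifies it.\<close>
  show "weights_of_cum (card K) ?t \<in> ?W"
    using t inv bij by (metis bij_betwE bij_betw_imp_surj_on imageE)
  fix v assume v: "v \<in> ?W" "v \<noteq> weights_of_cum (card K) ?t"
  then have "cum_weights (card K) v \<in> cum_cube (card K)" "cum_weights (card K) v \<noteq> ?t"
    using bij inv[of v] by (auto dest: bij_betwE)
  from mallows_crit_cum_gamma_ste_less[OF nz this]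
  show "mallows_crit x \<sigma> K y (weights_of_cum (card K) ?t) < mallows_crit x \<sigma> K y v"
    by (simp add: mallows_crit_eq_cum[OF K] cum_t)
qed

lemma ma_est_gamma_ste:
  "ma_est x K y (weights_of_cum (card K) (gamma_ste x \<sigma> K y))
    = (\<Sum>m=1..card K. max (1 - block_var \<sigma> K m / (norm (block_obs x K y m))\<^sup>2) 0
         *\<^sub>R block_obs x K y m)"
proof -
  have "gamma_ste x \<sigma> K y \<in> extensional {1..card K}" by (simp add: gamma_ste_def)
  then have "cum_weights (card K) (weights_of_cum (card K) (gamma_ste x \<sigma> K y)) = gamma_ste x \<sigma> K y"
    by (rule cum_weights_weights_of_cum)
  then show ?thesis
    unfolding ma_est_eq_sum_block_obs by (intro sum.cong) (auto simp: gamma_ste_def)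
qed

section \<open>Almost sure nonvanishing of the blocks\<close>

text \<open>Otherwise the columns with an index other than \<open>k\<close> would already span
  everything, forcing the dimension below \<open>p\<close>.\<close>

lemma column_not_in_span_previous:
  fixes x :: "nat \<Rightarrow> 'b::euclidean_space"
  assumes rank: "dim (x ` {1..p}) = p" and k: "l < k" "k \<le> p"
  shows "x k \<notin> span (x ` {1..l})"
proof
  assume "x k \<in> span (x ` {1..l})"
  moreover have "span (x ` {1..l}) \<subseteq> span (x ` ({1..p} - {k}))"
    using k by (intro span_mono image_mono) auto
  ultimately have "x ` {1..p} \<subseteq> span (x ` ({1..p} - {k}))"
    by (auto intro: span_base)
  then have "dim (x ` {1..p}) \<le> card (x ` ({1..p} - {k}))"
    by (rule dim_le_card) simp
  also have "\<dots> \<le> card ({1..p} - {k})" by (rule card_image_le) simp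
  also have "\<dots> < p" using k by simp
  finally show False using rank by simp
qed

text \<open>This reduces nonvanishing of a block vector to nonvanishing of a scalar linear
  functional of the data.\<close>

lemma block_obs_witness:
  fixes x :: "nat \<Rightarrow> real ^ 'n"
  assumes rank: "dim (x ` {1..p}) = p" and K: "K \<subseteq> {1..p}" and m: "m \<in> {1..card K}"
  obtains v where "v \<noteq> 0" "\<And>y. block_obs x K y m \<bullet> v = y \<bullet> v"
proof
  let ?k = "model_size K m" and ?l = "model_size K (m - 1)"
  \<comment> \<open>The part of the last column of model \<open>m\<close> orthogonal to model
    \<open>m - 1\<close>. It lies in the larger span and is orthogonal to the smaller one, so the
    residual at \<open>?k\<close> and the fit at \<open>?l\<close> both have inner product 0 with
    it.\<close>
  let ?v = "x ?k - proj_mat x ?l *v x ?k"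
  have fin: "finite K" "0 \<notin> K" using K finite_subset by auto
  have less: "?l < ?k" using fin m by (intro model_size_less) auto
  have k: "?k \<le> p" using model_size_mem[OF fin(1) m] K by auto
  from column_not_in_span_previous[OF rank less k] show "?v \<noteq> 0"
    using proj_mat_in_span[of x ?l "x ?k"] by auto
  have "x ?k \<in> span (x ` {1..?k})" using less by (intro span_base imageI) auto
  moreover have "proj_mat x ?l *v x ?k \<in> span (x ` {1..?k})"
    using proj_mat_in_span span_columns_mono[of ?l ?k x] less by fastforce
  ultimately have v: "?v \<in> span (x ` {1..?k})" by (rule span_diff)
  fix y
  have "(proj_mat x ?l *v y) \<bullet> ?v = 0"
    using orthogonal_proj_mat_residual[where y = "x ?k", OF proj_mat_in_span[of x ?l y]]
    by (simp add: orthogonal_def inner_commute)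
  moreover have "(y - proj_mat x ?k *v y) \<bullet> ?v = 0"
    using orthogonal_proj_mat_residual[OF v] by (simp add: orthogonal_def)
  ultimately show "block_obs x K y m \<bullet> ?v = y \<bullet> ?v"
    using m by (simp add: block_obs_eq inner_diff_left)
qed

text \<open>A law with a Lebesgue density gives no mass to a point.\<close>

lemma distributed_lborel_AE_neq:
  fixes X :: "'a \<Rightarrow> real"
  assumes "distributed M lborel X f"
  shows "AE \<omega> in M. X \<omega> \<noteq> c"
proof -
  have X: "X \<in> measurable M lborel" and f: "f \<in> borel_measurable lborel"
    using assms by (auto simp: distributed_def)
  have "AE z in density lborel f. z \<noteq> c"
    using AE_lborel_singleton[of c] by (subst AE_density[OF f]) auto
  then have "AE z in distr M lborel X. z \<noteq> c"
    by (simp only: distributed_distr_eq_density[OF assms])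
  from AE_distrD[OF X this] show ?thesis .
qed

lemma (in prob_space) indep_normal_AE_inner_neq:
  fixes \<epsilon> :: "'a \<Rightarrow> real ^ 'n" and v :: "real ^ 'n"
  assumes \<sigma>: "\<sigma> > 0"
    and normal: "\<And>i. distributed M lborel (\<lambda>\<omega>. \<epsilon> \<omega> $ i) (normal_density 0 \<sigma>)"
    and indep: "indep_vars (\<lambda>i. borel) (\<lambda>i \<omega>. \<epsilon> \<omega> $ i) UNIV"
    and v: "v \<noteq> 0"
  shows "AE \<omega> in M. \<epsilon> \<omega> \<bullet> v \<noteq> c"
proof -
  \<comment> \<open>On these coordinates every summand
    \<open>v $ i * \<epsilon> \<omega> $ i\<close> has positive standard deviation, as the theorem
    on sums of independent normals demands; \<open>v \<noteq> 0\<close> makes the index set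
    nonempty.\<close>
  define I where "I = {i. v $ i \<noteq> 0}"
  have "I \<noteq> {}" using v by (auto simp: I_def vec_eq_iff)
  have "distributed M lborel (\<lambda>\<omega>. \<Sum>i\<in>I. v $ i * \<epsilon> \<omega> $ i)
    (normal_density (\<Sum>i\<in>I. 0) (sqrt (\<Sum>i\<in>I. (\<bar>v $ i\<bar> * \<sigma>)\<^sup>2)))"
  proof (rule sum_indep_normal)
    have "indep_vars (\<lambda>i. borel) (\<lambda>i \<omega>. \<epsilon> \<omega> $ i) I"
      using indep by (rule indep_vars_subset) simp
    then show "indep_vars (\<lambda>i. borel) (\<lambda>i \<omega>. v $ i * \<epsilon> \<omega> $ i) I"
      by (rule indep_vars_compose2[where X = "\<lambda>i \<omega>. \<epsilon> \<omega> $ i" and Y = "\<lambda>i z. v $ i * z"]) simp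
    show "0 < \<bar>v $ i\<bar> * \<sigma>" if "i \<in> I" for i
      using that \<sigma> by (simp add: I_def)
    show "distributed M lborel (\<lambda>\<omega>. v $ i * \<epsilon> \<omega> $ i) (normal_density 0 (\<bar>v $ i\<bar> * \<sigma>))"
      if "i \<in> I" for i
      using normal_density_affine[OF normal \<sigma>, of "v $ i" 0 i] that by (simp add: I_def)
  qed (use \<open>I \<noteq> {}\<close> in auto)
  moreover have "\<epsilon> \<omega> \<bullet> v = (\<Sum>i\<in>I. v $ i * \<epsilon> \<omega> $ i)" for \<omega>
    unfolding inner_vec_def I_def
    by (intro sum.mono_neutral_cong_right) (auto simp: mult.commute)
  ultimately show ?thesis
    by (simp add: distributed_lborel_AE_neq)
qed

text \<open>Probability enters only through the first conjunct. The others are deterministic claims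
  at each outcome with nonzero blocks, and the equivalences for \<open>is_arg_min\<close> express
  existence and uniqueness at once.\<close>

theorem mainTheorem5:
  fixes \<Omega> :: "'a measure"
    and x :: "nat \<Rightarrow> real ^ 'n"
    and \<beta> :: "nat \<Rightarrow> real"
    and \<epsilon> :: "'a \<Rightarrow> real ^ 'n"
    and y :: "'a \<Rightarrow> real ^ 'n"
    and \<sigma> :: real
    and p :: nat
    and K :: "nat set"
  assumes "prob_space \<Omega>"
    and "p \<le> CARD('n)"
    and full_column_rank: "dim (x ` {1..p}) = p"
    and "\<sigma> > 0"
    and normal: "\<And>i. distributed \<Omega> lborel (\<lambda>\<omega>. \<epsilon> \<omega> $ i) (normal_density 0 \<sigma>)"
    and indep: "prob_space.indep_vars \<Omega> (\<lambda>i. borel) (\<lambda>i \<omega>. \<epsilon> \<omega> $ i) UNIV"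
    and y: "\<And>\<omega>. \<omega> \<in> space \<Omega> \<Longrightarrow> y \<omega> = (\<Sum>j=1..p. \<beta> j *\<^sub>R x j) + \<epsilon> \<omega>"
    and "K \<subseteq> {1..p}"
  shows "(AE \<omega> in \<Omega>. \<forall>m\<in>{1..card K}. block_obs x K (y \<omega>) m \<noteq> 0) \<and>
    (\<forall>\<omega>\<in>space \<Omega>. (\<forall>m\<in>{1..card K}. block_obs x K (y \<omega>) m \<noteq> 0) \<longrightarrow>
      (\<forall>w. mallows_crit x \<sigma> K (y \<omega>) w
             = mallows_crit_cum x \<sigma> K (y \<omega>) (cum_weights (card K) w)) \<and>
      bij_betw (cum_weights (card K)) (weight_set (card K)) (cum_cube (card K)) \<and>
      (\<forall>w\<in>weight_set (card K). weights_of_cum (card K) (cum_weights (card K) w) = w) \<and>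
      (\<forall>\<gamma>. is_arg_min (mallows_crit_cum x \<sigma> K (y \<omega>)) (\<lambda>g. g \<in> cum_cube (card K)) \<gamma>
             \<longleftrightarrow> \<gamma> = gamma_ste x \<sigma> K (y \<omega>)) \<and>
      (\<forall>w. is_arg_min (mallows_crit x \<sigma> K (y \<omega>)) (\<lambda>v. v \<in> weight_set (card K)) w
             \<longleftrightarrow> w = weights_of_cum (card K) (gamma_ste x \<sigma> K (y \<omega>))) \<and>
      ma_est x K (y \<omega>) (weights_of_cum (card K) (gamma_ste x \<sigma> K (y \<omega>)))
        = (\<Sum>m=1..card K.
             max (1 - block_var \<sigma> K m / (norm (block_obs x K (y \<omega>) m))\<^sup>2) 0
               *\<^sub>R block_obs x K (y \<omega>) m))"
proof (intro conjI ballI impI)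
  interpret prob_space \<Omega> by fact
  have K: "finite K" "0 \<notin> K"
    using \<open>K \<subseteq> {1..p}\<close> finite_subset by auto
  show "AE \<omega> in \<Omega>. \<forall>m\<in>{1..card K}. block_obs x K (y \<omega>) m \<noteq> 0"
  proof (rule AE_finite_allI)
    fix m assume m: "m \<in> {1..card K}"
    obtain v where v: "v \<noteq> 0" "\<And>z. block_obs x K z m \<bullet> v = z \<bullet> v"
      by (rule block_obs_witness[OF full_column_rank \<open>K \<subseteq> {1..p}\<close> m]) blast
    \<comment> \<open>The excluded value is the one at which the noise cancels the mean, that is,
      where \<open>y \<omega> \<bullet> v = 0\<close>.\<close>
    have "AE \<omega> in \<Omega>. \<epsilon> \<omega> \<bullet> v \<noteq> - ((\<Sum>j=1..p. \<beta> j *\<^sub>R x j) \<bullet> v)"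
      using \<open>\<sigma> > 0\<close> normal indep v(1) by (rule indep_normal_AE_inner_neq)
    then show "AE \<omega> in \<Omega>. block_obs x K (y \<omega>) m \<noteq> 0"
      \<comment> \<open>The model equation for \<open>y\<close> is given only on
        \<open>space \<Omega>\<close>.\<close>
      using AE_space
    proof eventually_elim
      case (elim \<omega>)
      then have "y \<omega> \<bullet> v \<noteq> 0" by (simp add: y inner_add_left)
      with v(2)[of "y \<omega>"] show ?case by auto
    qed
  qed simp
  fix \<omega> assume nz: "\<forall>m\<in>{1..card K}. block_obs x K (y \<omega>) m \<noteq> 0"
  show "\<forall>w. mallows_crit x \<sigma> K (y \<omega>) w
      = mallows_crit_cum x \<sigma> K (y \<omega>) (cum_weights (card K) w)"
    by (intro allI mallows_crit_eq_cum K)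
  show "bij_betw (cum_weights (card K)) (weight_set (card K)) (cum_cube (card K))"
    by (rule bij_betw_cum_weights)
  show "weights_of_cum (card K) (cum_weights (card K) w) = w" if "w \<in> weight_set (card K)" for w
    using that by (simp add: weight_set_def weights_of_cum_cum_weights)
  show "\<forall>\<gamma>. is_arg_min (mallows_crit_cum x \<sigma> K (y \<omega>)) (\<lambda>g. g \<in> cum_cube (card K)) \<gamma>
      \<longleftrightarrow> \<gamma> = gamma_ste x \<sigma> K (y \<omega>)"
    by (intro allI is_arg_min_mallows_crit_cum K nz)
  show "\<forall>w. is_arg_min (mallows_crit x \<sigma> K (y \<omega>)) (\<lambda>v. v \<in> weight_set (card K)) w
      \<longleftrightarrow> w = weights_of_cum (card K) (gamma_ste x \<sigma> K (y \<omega>))"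
    by (intro allI is_arg_min_mallows_crit K nz)
  show "ma_est x K (y \<omega>) (weights_of_cum (card K) (gamma_ste x \<sigma> K (y \<omega>)))
    = (\<Sum>m=1..card K. max (1 - block_var \<sigma> K m / (norm (block_obs x K (y \<omega>) m))\<^sup>2) 0
         *\<^sub>R block_obs x K (y \<omega>) m)"
    by (rule ma_est_gamma_ste)
qed

end
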